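(* Let $k$ be an odd positive integer and let $F_k:\mathbb{N}\to\mathbb{N}$ be given by $F_k(n)=\frac{3n+k}{2}$ if $n$ is odd and $F_k(n)=\frac{n}{2}$ if $n$ is even. Let $u_1,d_1,\dots,u_s,d_s$ be positive integers, $U=\sum u_i$, $D=\sum d_i$, $\beta=2^{U+D}-3^U$, and for a sequence $(v_1,e_1,\dots,v_s,e_s)$ of positive integers put $$\alpha(v_1,e_1,\dots,v_s,e_s)=\sum_{i=1}^{s} 2^{\sum_{j=1}^{i-1}(v_j+e_j)}\,(3^{v_i}-2^{v_i})\,3^{\sum_{j=i+1}^{s}v_j}.$$ Let $\alpha=\alpha(u_1,d_1,\dots,u_s,d_s)$ and $\alpha'=\alpha(u_2,d_2,\dots,u_s,d_s,u_1,d_1)$. Suppose $T_0=k\alpha/\beta$ is an element of a cycle of $F_k$ whose trajectory from $T_0$ follows the orb sequence $(u_1,d_1,\dots,u_s,d_s)$ and returns to $T_0$. Then the element of the cycle one orb after $T_0$ is $$F_k^{u_1+d_1}(T_0)=\frac{k\alpha'}{\beta}.$$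
   Context: The trajectory of $T_0$ follows the orb sequence $(u_1,d_1,\dots,u_s,d_s)$ if, with $x_0=T_0$, $x_{t+1}=F_k(x_t)$, among $x_0,\dots,x_{U+D-1}$ the first $u_1$ are odd, the next $d_1$ even, the next $u_2$ odd, etc., ending with $d_s$ even values. *)

theory Defs
  imports Complex_Main "HOL-Combinatorics.Orbits"
begin

definition F :: "nat \<Rightarrow> nat \<Rightarrow> nat" where
  "F k n = (if odd n then (3 * n + k) div 2 else n div 2)"

text \<open>
  An orb sequence \<open>(u\<^sub>1, d\<^sub>1, \<dots>, u\<^sub>s, d\<^sub>s)\<close> is represented by the list of pairs
  \<open>[(u\<^sub>1, d\<^sub>1), \<dots>, (u\<^sub>s, d\<^sub>s)]\<close>.  List positions start at 0, so the index \<open>i\<close> below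
  is one less than the customary one.
\<close>

definition alpha :: "(nat \<times> nat) list \<Rightarrow> int" where
  "alpha os =
     (\<Sum>i<length os.
        2 ^ (\<Sum>j<i. fst (os ! j) + snd (os ! j))
        * (3 ^ fst (os ! i) - 2 ^ fst (os ! i))
        * 3 ^ (\<Sum>j\<in>{i<..<length os}. fst (os ! j)))"

definition up_total :: "(nat \<times> nat) list \<Rightarrow> nat" where
  "up_total os = sum_list (map fst os)"

definition down_total :: "(nat \<times> nat) list \<Rightarrow> nat" where
  "down_total os = sum_list (map snd os)"

definition beta :: "(nat \<times> nat) list \<Rightarrow> int" where
  "beta os = 2 ^ (up_total os + down_total os) - 3 ^ up_total os"

text \<open>
  The parities of the first \<open>U + D\<close> iterates (\<open>True\<close> for odd) are \<open>u\<^sub>1\<close> times odd,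
  then \<open>d\<^sub>1\<close> times even, then \<open>u\<^sub>2\<close> times odd, and so on.
\<close>

definition follows_orbs :: "nat \<Rightarrow> nat \<Rightarrow> (nat \<times> nat) list \<Rightarrow> bool" where
  "follows_orbs k T os \<longleftrightarrow>
     map (\<lambda>t. odd ((F k ^^ t) T)) [0..<up_total os + down_total os] =
     concat (map (\<lambda>(u, d). replicate u True @ replicate d False) os)"

end

theory Submission
  imports Defs
begin

text \<open>
  An odd step satisfies \<open>2 (F\<^sub>k n + k) = 3 (n + k)\<close>, so an orb \<open>(u, d)\<close> starting in \<open>T\<close> and ending
  in \<open>T'\<close> satisfies \<open>2\<^sup>u\<^sup>+\<^sup>d T' = 3\<^sup>u (T + k) - 2\<^sup>u k\<close>.  Moving this orb from the front of the orb
  sequence to its end transforms \<open>\<alpha>\<close> by the same affine rule, with \<open>\<beta>\<close> in place of \<open>k\<close>,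
  and scaling by \<open>k / \<beta>\<close> turns the second rule into the first.
\<close>

text \<open>The first summand splits off. In every later one the power of 2 runs over the earlier
  pairs and so gains the factor \<open>2 ^ (u + d)\<close>, while the power of 3 sees only later
  pairs and is unchanged.\<close>

lemma alpha_Cons:
  "alpha ((u, d) # os) = (3 ^ u - 2 ^ u) * 3 ^ up_total os + 2 ^ (u + d) * alpha os"
proof -
  have shift: "(\<Sum>j\<in>{Suc i<..<Suc n}. fst (((u, d) # os) ! j)) = (\<Sum>j\<in>{i<..<n}. fst (os ! j))"
    for i n
  proof -
    have "{Suc i<..<Suc n} = Suc ` {i<..<n}"
      by (auto simp: image_iff Suc_less_eq2)
    then show ?thesis
      by (simp add: sum.reindex)
  qed
  have "{0<..<Suc (length os)} = Suc ` {..<length os}"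
    by (auto simp: image_iff gr0_conv_Suc)
  then have "(\<Sum>j\<in>{0<..<Suc (length os)}. fst (((u, d) # os) ! j)) = up_total os"
    by (simp add: up_total_def sum.reindex sum_list_sum_nth atLeast0LessThan)
  then show ?thesis
    unfolding alpha_def length_Cons sum.lessThan_Suc_shift shift
    by (simp add: sum_distrib_left power_add mult.assoc)
qed

text \<open>The new pair is later than all others, so each old summand gains the factor
  \<open>3 ^ u\<close>, and the new summand carries the full power of 2. Induction via
  \<open>alpha_Cons\<close> avoids splitting the sum at its far end.\<close>

lemma alpha_snoc:
  "alpha (os @ [(u, d)]) =
     3 ^ u * alpha os + 2 ^ (up_total os + down_total os) * (3 ^ u - 2 ^ u)"
proof (induction os)
  case Nil
  show ?case
    by (simp add: alpha_def up_total_def down_total_def)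
next
  case (Cons p os)
  obtain a b where p: "p = (a, b)"
    by fastforce
  show ?case
    unfolding p append_Cons alpha_Cons Cons.IH
    by (simp add: up_total_def down_total_def power_add algebra_simps)
qed

text \<open>Both sides contain \<open>2 ^ (u + d) * 3 ^ u * alpha os\<close>. What remains is
  \<open>3 ^ u - 2 ^ u\<close> times \<open>2 ^ (U + D)\<close> on the left and times
  \<open>3 ^ U + beta ((u, d) # os)\<close> on the right, where \<open>U\<close> and
  \<open>D\<close> are the totals of \<open>(u, d) # os\<close>.\<close>

lemma alpha_rotate:
  "2 ^ (u + d) * alpha (os @ [(u, d)]) =
     3 ^ u * (alpha ((u, d) # os) + beta ((u, d) # os)) - 2 ^ u * beta ((u, d) # os)"
  by (simp add: alpha_Cons alpha_snoc beta_def up_total_def down_total_def power_add algebra_simps)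

lemma beta_nonzero:
  assumes "up_total os + down_total os > 0"
  shows "beta os \<noteq> 0"
proof -
  \<comment> \<open>A positive power of 2 minus a power of 3 is odd, whatever its sign.\<close>
  have "odd (beta os)"
    using assms by (simp add: beta_def)
  then show ?thesis
    by auto
qed

lemma F_odd: "odd k \<Longrightarrow> odd n \<Longrightarrow> 2 * F k n = 3 * n + k"
  by (simp add: F_def)

lemma F_even: "even n \<Longrightarrow> 2 * F k n = n"
  by (simp add: F_def)

text \<open>The map n -> (3n + k)/2 fixes -k. Measured from there it is multiplication by 3/2, which
  iterates without accumulating constants.\<close>

lemma F_funpow_odd:
  assumes "odd k" "\<And>t. t < u \<Longrightarrow> odd ((F k ^^ t) T)"
  shows "2 ^ u * ((F k ^^ u) T + k) = 3 ^ u * (T + k)"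
  using assms(2)
proof (induction u)
  case (Suc u)
  have "2 * (F k ((F k ^^ u) T) + k) = 3 * ((F k ^^ u) T + k)"
    using F_odd[OF \<open>odd k\<close> Suc.prems[of u]] by simp
  then have "2 ^ Suc u * ((F k ^^ Suc u) T + k) = 3 * (2 ^ u * ((F k ^^ u) T + k))"
    by (simp add: mult.left_commute)
  with Suc show ?case
    by simp
qed simp

lemma F_funpow_even:
  assumes "\<And>t. t < d \<Longrightarrow> even ((F k ^^ t) T)"
  shows "2 ^ d * (F k ^^ d) T = T"
  using assms
proof (induction d)
  case (Suc d)
  have "2 * F k ((F k ^^ d) T) = (F k ^^ d) T"
    using Suc.prems[of d] by (intro F_even) simp
  then have "2 ^ Suc d * (F k ^^ Suc d) T = 2 ^ d * (F k ^^ d) T"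
    by (simp add: mult.left_commute)
  with Suc show ?case
    by simp
qed simp

text \<open>In \<open>t + u\<close> the summands are ordered so that \<open>funpow_add\<close> reads
  it as \<open>t\<close> steps from the end of the odd run.\<close>

lemma follows_orbs_Cons:
  assumes "follows_orbs k T ((u, d) # os)"
  shows "t < u \<Longrightarrow> odd ((F k ^^ t) T)"
    and "t < d \<Longrightarrow> even ((F k ^^ (t + u)) T)"
proof -
  define n where "n = up_total ((u, d) # os) + down_total ((u, d) # os)"
  have n: "u + d \<le> n"
    by (simp add: n_def up_total_def down_total_def)
  have parities: "odd ((F k ^^ i) T) = ((replicate u True @ replicate d False) ! i)"
    if "i < u + d" for i
  proof -
    have "map (\<lambda>t. odd ((F k ^^ t) T)) [0..<n] ! i =
        ((replicate u True @ replicate d False) @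
          concat (map (\<lambda>(u, d). replicate u True @ replicate d False) os)) ! i"
      using assms by (simp add: follows_orbs_def n_def)
    then show ?thesis
      using that n by (subst (asm) nth_append) simp
  qed
  show "odd ((F k ^^ t) T)" if "t < u"
    using parities[of t] that by (simp add: nth_append)
  show "even ((F k ^^ (t + u)) T)" if "t < d"
    using parities[of "t + u"] that by (simp add: nth_append)
qed

text \<open>The term \<open>2 ^ u * k\<close> stands on the left because subtraction on
  \<open>nat\<close> truncates.\<close>

lemma F_funpow_orb:
  assumes "odd k" "follows_orbs k T ((u, d) # os)"
  shows "2 ^ (u + d) * (F k ^^ (u + d)) T + 2 ^ u * k = 3 ^ u * (T + k)"
proof -
  have "2 ^ d * (F k ^^ d) ((F k ^^ u) T) = (F k ^^ u) T"
    using follows_orbs_Cons(2)[OF assms(2)] by (intro F_funpow_even) (simp add: funpow_add)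
  then have "2 ^ d * (F k ^^ (u + d)) T = (F k ^^ u) T"
    by (simp add: add.commute[of u] funpow_add)
  moreover have "2 ^ u * ((F k ^^ u) T + k) = 3 ^ u * (T + k)"
    using assms(1) follows_orbs_Cons(1)[OF assms(2)] by (rule F_funpow_odd)
  ultimately show ?thesis
    by (simp add: power_add distrib_left mult.assoc)
qed

theorem theorem9:
  fixes k T0 u1 d1 :: nat and rest os :: "(nat \<times> nat) list" and C :: "nat set"
  assumes k: "odd k" "k > 0"
    and os: "os = (u1, d1) # rest"
    and pos: "\<forall>(u, d)\<in>set os. u > 0 \<and> d > 0"
    and T0: "real T0 = real k * real_of_int (alpha os) / real_of_int (beta os)"
    and cycle: "cyclic_on (F k) C" "T0 \<in> C"
    and follows: "follows_orbs k T0 os"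
    and returns: "(F k ^^ (up_total os + down_total os)) T0 = T0"
  shows "real ((F k ^^ (u1 + d1)) T0) =
           real k * real_of_int (alpha (rest @ [(u1, d1)])) / real_of_int (beta os)"
proof -
  define a b a' x where "a = real_of_int (alpha os)" and "b = real_of_int (beta os)"
    and "a' = real_of_int (alpha (rest @ [(u1, d1)]))" and "x = real ((F k ^^ (u1 + d1)) T0)"
  have "b \<noteq> 0"
    using beta_nonzero[of os] pos os by (simp add: b_def up_total_def)
  then have T0b: "real T0 * b = real k * a"
    using T0 by (simp add: a_def b_def)
  have "real (2 ^ (u1 + d1) * (F k ^^ (u1 + d1)) T0 + 2 ^ u1 * k) = real (3 ^ u1 * (T0 + k))"
    using F_funpow_orb k(1) follows os by metis
  then have orb: "2 ^ (u1 + d1) * x = 3 ^ u1 * (real T0 + real k) - 2 ^ u1 * real k"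
    by (simp add: x_def)
  have "real_of_int (2 ^ (u1 + d1) * alpha (rest @ [(u1, d1)])) =
      real_of_int (3 ^ u1 * (alpha os + beta os) - 2 ^ u1 * beta os)"
    unfolding os alpha_rotate ..
  then have rotate: "2 ^ (u1 + d1) * a' = 3 ^ u1 * (a + b) - 2 ^ u1 * b"
    by (simp add: a_def b_def a'_def)
  \<comment> \<open>The factor \<open>b\<close> lets \<open>T0b\<close> replace
    \<open>real T0 * b\<close> by \<open>real k * a\<close>; then \<open>k\<close> factors out,
    \<open>rotate\<close> applies, and the power of 2 cancels.\<close>
  have "2 ^ (u1 + d1) * (x * b) = (3 ^ u1 * (real T0 + real k) - 2 ^ u1 * real k) * b"
    using orb by (simp add: mult.assoc[symmetric])
  also have "\<dots> = 3 ^ u1 * (real T0 * b) + (3 ^ u1 - 2 ^ u1) * real k * b"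
    by (simp add: algebra_simps)
  also have "\<dots> = real k * (3 ^ u1 * (a + b) - 2 ^ u1 * b)"
    unfolding T0b by (simp add: algebra_simps)
  also have "\<dots> = 2 ^ (u1 + d1) * (real k * a')"
    unfolding rotate[symmetric] by simp
  finally have "x * b = real k * a'"
    by simp
  with \<open>b \<noteq> 0\<close> show ?thesis
    by (simp add: x_def a'_def b_def field_simps)
qed

end
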